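(* Fix a BST algorithm $\mathcal{A}$ and a constant $\epsilon<1$. There exists $U' \subseteq U$ of size $\vert U' \vert \geq \left(1-\frac{1}{\vert U \vert^{\epsilon}}\right)\vert U \vert$ such that $\mathcal{A}$ requires $\Omega(\log \vert U \vert + n)$ access cost on any permutation in $U'$.
   Context: Let $U$ be a set of permutations of $[n]=\{1,\dots,n\}$. A permutation $\pi$ is viewed as the access sequence $\pi(1),\pi(2),\dots,\pi(n)$ served by a binary search tree algorithm on the keys $[n]$. In the BST model, serving an operation at time $t$ consists of replacing a connected subtree $\tau_t$ containing the root by a tree $\tau_t'$ on the same nodes (for an access, the accessed key must lie in $\tau_t$), with cost $\max\{|\tau_t|,|\tau_t'|\}$; the access cost of $\mathcal{A}$ on $\pi$ is the sum of these costs over all accesses (equivalently, the total number of keys touched over all times). $\mathcal{A}$ may be designed to work only on the permutations in $U$. *)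

theory Defs
  imports Complex_Main "HOL-Library.Tree" "HOL-Combinatorics.Permutations"
begin

(* root_subtree s hs T: s is a connected subtree of T that contains the root
   (or is empty), and hs lists, from left to right, the (possibly empty)
   subtrees of T hanging below s, one for each Leaf of s. *)
inductive root_subtree :: "'a tree \<Rightarrow> 'a tree list \<Rightarrow> 'a tree \<Rightarrow> bool" where
  Leaf: "root_subtree Leaf [T] T"
| Node: "root_subtree l hs L \<Longrightarrow> root_subtree r hs' R \<Longrightarrow>
    root_subtree (Node l a r) (hs @ hs') (Node L a R)"

(* T' arises from T by replacing s by s'. As s and s' are search trees on the same
   keys, their Leaf positions correspond in left-to-right order, so reattaching the
   same list hs is the only way to obtain a search tree again. *)
definition replaces :: "'a::linorder tree \<Rightarrow> 'a tree \<Rightarrow> 'a tree \<Rightarrow> 'a tree \<Rightarrow> bool" where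
  "replaces T s s' T' \<longleftrightarrow>
     (\<exists>hs. root_subtree s hs T \<and> root_subtree s' hs T') \<and>
     bst s' \<and> set_tree s' = set_tree s"

(* The list of pairs records the subtrees (s, s') replaced at each time step. The
   condition x \<in> set_tree s also makes s nonempty, so that s contains the root. *)
inductive serves ::
    "'a::linorder tree \<Rightarrow> 'a list \<Rightarrow> ('a tree \<times> 'a tree) list \<Rightarrow> bool" where
  Nil: "serves T [] []"
| Cons: "replaces T s s' T' \<Longrightarrow> x \<in> set_tree s \<Longrightarrow> serves T' xs steps \<Longrightarrow>
    serves T (x # xs) ((s, s') # steps)"

definition access_seq :: "nat \<Rightarrow> (nat \<Rightarrow> nat) \<Rightarrow> nat list" where
  "access_seq n \<pi> = map \<pi> [1..<Suc n]"

(* An execution consists of an initial tree and the replacements performed. *)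
type_synonym execution = "nat tree \<times> (nat tree \<times> nat tree) list"

(* Algorithms may be offline, and need only work on the permutations in U;
   the initial tree is chosen by the algorithm. *)
definition bst_algorithm ::
    "nat \<Rightarrow> (nat \<Rightarrow> nat) set \<Rightarrow> ((nat \<Rightarrow> nat) \<Rightarrow> execution) \<Rightarrow> bool" where
  "bst_algorithm n U A \<longleftrightarrow>
     (\<forall>\<pi>\<in>U. case A \<pi> of (T, steps) \<Rightarrow>
        bst T \<and> set_tree T = {1..n} \<and> serves T (access_seq n \<pi>) steps)"

definition access_cost :: "((nat \<Rightarrow> nat) \<Rightarrow> execution) \<Rightarrow> (nat \<Rightarrow> nat) \<Rightarrow> nat" where
  "access_cost A \<pi> = (\<Sum>(s, s') \<leftarrow> snd (A \<pi>). max (size s) (size s'))"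

end

theory Submission
  imports Defs
begin

text \<open>
  An execution is recorded as a bit string: the shape of the initial tree, followed, for every
  access, by the shapes of the replaced and of the replacing subtree and by the position of the
  accessed key in the former. Keys need not be recorded, since they can be read off the current
  tree. This string determines the access sequence. As the access cost is at least \<open>n\<close>, an
  execution of access cost at most \<open>k\<close> has a string of length at most \<open>9 * k + 1\<close>. Hence at most \<open>2 ^ (11 * k)\<close>
  permutations have access cost at most \<open>k\<close> if \<open>k \<ge> 1\<close>, and \<open>k\<close> proportional to \<open>(1 - \<epsilon>) * log 2 (card U)\<close> gives the bound.
\<close>

section \<open>Tree shapes and their bit codes\<close>

abbreviation shape :: "'a tree \<Rightarrow> unit tree" where
  "shape \<equiv> map_tree (\<lambda>_. ())"

fun shape_code :: "'a tree \<Rightarrow> bool list" where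
  "shape_code Leaf = [False]"
| "shape_code (Node l a r) = True # shape_code l @ shape_code r"

lemma length_shape_code [simp]: "length (shape_code t) = 2 * size t + 1"
  by (induction t) auto

text \<open>The preorder code marks every leaf by \<open>False\<close>, so a decoder notices where a
  tree ends. The arbitrary tails \<open>u\<close> and \<open>v\<close> allow concatenated codes to
  be parsed from the left.\<close>

lemma shape_code_append_eqD:
  "shape_code s @ u = shape_code t @ v \<Longrightarrow> shape s = shape t \<and> u = v"
proof (induction s arbitrary: t u v)
  case Leaf
  then show ?case by (cases t) auto
next
  case (Node l a r)
  from Node.prems obtain l' b r' where t: "t = Node l' b r'" by (cases t) auto
  with Node.prems have "shape_code l @ shape_code r @ u = shape_code l' @ shape_code r' @ v"
    by simp
  from Node.IH(1)[OF this] Node.IH(2)[of u r' v] t show ?case by simp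
qed

lemma size_eq_if_shape_eq: "shape s = shape t \<Longrightarrow> size s = size t"
  by (metis size_map_tree)

text \<open>The shape fixes the size of the left subtree and thereby the place where the inorder
  list splits.\<close>

lemma tree_eq_if_shape_inorder_eq:
  "shape s = shape t \<Longrightarrow> inorder s = inorder t \<Longrightarrow> s = t"
proof (induction s arbitrary: t)
  case Leaf
  then show ?case by (cases t) auto
next
  case (Node l a r)
  from Node.prems(1) obtain l' b r' where t: "t = Node l' b r'" by (cases t) auto
  with Node.prems have "size l = size l'" by (auto intro: size_eq_if_shape_eq)
  then have "length (inorder l) = length (inorder l')" by simp
  with Node t show ?case by auto
qed

lemma inorder_eq_sorted_list_of_set: "bst t \<Longrightarrow> inorder t = sorted_list_of_set (set_tree t)"
  by (rule strict_sorted_equal) (simp_all flip: bst_iff_sorted_wrt_less)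

lemma size_bst: "bst t \<Longrightarrow> size t = card (set_tree t)"
  using arg_cong[OF inorder_eq_sorted_list_of_set, of t length] by simp

lemma bst_eq_if_shape_set_eq:
  "bst s \<Longrightarrow> bst t \<Longrightarrow> shape s = shape t \<Longrightarrow> set_tree s = set_tree t \<Longrightarrow> s = t"
  by (simp add: inorder_eq_sorted_list_of_set tree_eq_if_shape_inorder_eq)

section \<open>Determinism of replacements\<close>

inductive_cases root_subtree_LeafE: "root_subtree Leaf hs T"
inductive_cases root_subtree_NodeE: "root_subtree (Node l a r) hs T"

lemma root_subtree_length: "root_subtree s hs T \<Longrightarrow> length hs = size s + 1"
  by (induction rule: root_subtree.induct) auto

text \<open>Walking down \<open>T\<close> along the shape copies the keys from \<open>T\<close> and
  leaves the hanging subtrees behind.\<close>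

lemma root_subtree_unique:
  "root_subtree s hs T \<Longrightarrow> root_subtree t hs' T \<Longrightarrow> shape s = shape t \<Longrightarrow> s = t \<and> hs = hs'"
proof (induction arbitrary: t hs' rule: root_subtree.induct)
  case (Leaf T)
  then show ?case by (cases t) (auto elim: root_subtree_LeafE)
next
  case (Node l hs L r hs2 R a)
  from Node.prems(2) obtain l' b r' where t: "t = tree.Node l' b r'" "shape l = shape l'" "shape r = shape r'"
    by (cases t) auto
  from Node.prems(1) obtain ks ks' where
    "b = a" "hs' = ks @ ks'" "root_subtree l' ks L" "root_subtree r' ks' R"
    unfolding t(1) by (auto elim: root_subtree_NodeE)
  with Node.IH t show ?case by blast
qed

text \<open>The sizes of the left and right parts of \<open>s\<close> fix the lengths of their lists
  of hanging subtrees, so \<open>hs\<close> splits in only one way.\<close>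

lemma root_subtree_determines_tree:
  "root_subtree s hs T \<Longrightarrow> root_subtree s hs T' \<Longrightarrow> T = T'"
proof (induction arbitrary: T' rule: root_subtree.induct)
  case (Leaf T)
  then show ?case by (auto elim: root_subtree_LeafE)
next
  case (Node l hs L r hs2 R a)
  from Node.prems obtain ks ks' L' R' where
    *: "hs @ hs2 = ks @ ks'" "root_subtree l ks L'" "root_subtree r ks' R'" "T' = tree.Node L' a R'"
    by (auto elim: root_subtree_NodeE)
  from Node.hyps(1) *(2) have "length hs = length ks" by (simp add: root_subtree_length)
  with * Node.IH show ?case by auto
qed

text \<open>Decodes one replacement: \<open>s\<close> and its hanging subtrees are read off
  \<open>T\<close>, \<open>s'\<close> is the search tree of known shape on the keys of
  \<open>s\<close>, and reattaching the subtrees yields \<open>T'\<close>.\<close>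

lemma replaces_unique:
  assumes "replaces T s s' T'" "replaces T t t' T''" "shape s = shape t" "shape s' = shape t'"
  shows "s = t" "T' = T''"
proof -
  from assms(1) obtain hs where s: "root_subtree s hs T" "root_subtree s' hs T'"
    "bst s'" "set_tree s' = set_tree s" unfolding replaces_def by blast
  from assms(2) obtain ks where t: "root_subtree t ks T" "root_subtree t' ks T''"
    "bst t'" "set_tree t' = set_tree t" unfolding replaces_def by blast
  from root_subtree_unique[OF s(1) t(1) assms(3)] have st: "s = t" "hs = ks" by auto
  with s t assms(4) have "s' = t'" by (auto intro: bst_eq_if_shape_set_eq)
  with s t st show "s = t" "T' = T''" by (auto intro: root_subtree_determines_tree)
qed

section \<open>Encoding of runs\<close>

definition position :: "'a \<Rightarrow> 'a list \<Rightarrow> nat" where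
  "position x xs = length (takeWhile (\<lambda>y. y \<noteq> x) xs)"

lemma position_less: "x \<in> set xs \<Longrightarrow> position x xs < length xs"
  by (induction xs) (auto simp: position_def)

lemma nth_position: "x \<in> set xs \<Longrightarrow> xs ! position x xs = x"
  using position_less[of x xs] nth_length_takeWhile[of "\<lambda>y. y \<noteq> x" xs]
  unfolding position_def by auto

text \<open>The final \<open>False\<close> makes the code self-delimiting. Unary is short enough
  here: a position in \<open>s\<close> takes at most \<open>size s\<close> bits.\<close>

definition unary :: "nat \<Rightarrow> bool list" where
  "unary i = replicate i True @ [False]"

lemma unary_append_eqD: "unary i @ u = unary j @ v \<Longrightarrow> i = j \<and> u = v"
proof (induction i arbitrary: j)
  case 0
  then show ?case by (cases j) (auto simp: unary_def)
next
  case (Suc i)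
  then show ?case by (cases j) (auto simp: unary_def)
qed

fun run_code :: "'a list \<Rightarrow> ('a tree \<times> 'a tree) list \<Rightarrow> bool list" where
  "run_code (x # xs) ((s, s') # steps) =
     shape_code s @ shape_code s' @ unary (position x (inorder s)) @ run_code xs steps"
| "run_code _ _ = []"

text \<open>Both runs start from the same tree, and equal codes of the first access force the same
  key and the same next tree, so decoding can continue from there.\<close>

lemma run_code_inj:
  "serves T xs steps \<Longrightarrow> serves T ys steps' \<Longrightarrow> length xs = length ys \<Longrightarrow>
    run_code xs steps = run_code ys steps' \<Longrightarrow> xs = ys"
proof (induction arbitrary: ys steps' rule: serves.induct)
  case (Nil T)
  then show ?case by simp
next
  case (Cons T s s' T' x xs steps)
  from Cons.prems obtain t t' T'' y zs steps'' where
    y: "ys = y # zs" "steps' = (t, t') # steps''" "replaces T t t' T''" "y \<in> set_tree t"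
      "serves T'' zs steps''"
    by (auto elim: serves.cases)
  let ?i = "position x (inorder s)" and ?j = "position y (inorder t)"
  have "shape_code s @ shape_code s' @ unary ?i @ run_code xs steps =
      shape_code t @ shape_code t' @ unary ?j @ run_code zs steps''"
    using Cons.prems y by simp
  then have *: "shape s = shape t" "shape s' = shape t'" "?i = ?j"
      "run_code xs steps = run_code zs steps''"
    by (auto dest!: shape_code_append_eqD unary_append_eqD)
  from replaces_unique[OF Cons.hyps(1) y(3) *(1,2)] have st: "s = t" "T' = T''" .
  have "x = y"
    using *(3) Cons.hyps(2) y(4) st(1) by (metis nth_position set_inorder)
  moreover have "xs = zs" using Cons.IH Cons.prems y * st by auto
  ultimately show ?case using y by simp
qed

abbreviation steps_cost :: "('a tree \<times> 'a tree) list \<Rightarrow> nat" where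
  "steps_cost steps \<equiv> (\<Sum>(s, s') \<leftarrow> steps. max (size s) (size s'))"

text \<open>An access of cost m has m \<ge> 1, as \<open>s\<close> contains the accessed key. Its
  code has at most 2 * (2 * m + 1) bits for the two shapes and m bits for the position, thus at most
  7 * m.\<close>

lemma serves_cost_bounds:
  "serves T xs steps \<Longrightarrow>
    length xs \<le> steps_cost steps \<and> length (run_code xs steps) \<le> 7 * steps_cost steps"
proof (induction rule: serves.induct)
  case (Nil T)
  then show ?case by simp
next
  case (Cons T s s' T' x xs steps)
  have "position x (inorder s) < size s"
    using position_less[of x "inorder s"] Cons.hyps(2) by simp
  with Cons.IH show ?case by (auto simp: unary_def)
qed

section \<open>Counting permutations of low access cost\<close>

lemma length_access_seq [simp]: "length (access_seq n \<pi>) = n"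
  by (simp add: access_seq_def del: upt_Suc)

lemma access_seq_inj:
  assumes "\<pi> permutes {1..n}" "\<sigma> permutes {1..n}" "access_seq n \<pi> = access_seq n \<sigma>"
  shows "\<pi> = \<sigma>"
proof
  fix i
  show "\<pi> i = \<sigma> i"
  proof (cases "i \<in> {1..n}")
    case True
    then show ?thesis using assms(3) by (auto simp: access_seq_def)
  next
    case False
    then show ?thesis using assms(1,2) by (metis permutes_not_in)
  qed
qed

lemma access_cost_ge:
  assumes "bst_algorithm n U A" "\<pi> \<in> U"
  shows "n \<le> access_cost A \<pi>"
proof -
  from assms have "serves (fst (A \<pi>)) (access_seq n \<pi>) (snd (A \<pi>))"
    by (auto simp: bst_algorithm_def)
  from serves_cost_bounds[OF this] show ?thesis
    by (simp add: access_cost_def)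
qed

lemma card_cheap_permutations:
  assumes U: "U \<subseteq> {\<pi>. \<pi> permutes {1..n}}" and A: "bst_algorithm n U A"
  shows "card {\<pi>\<in>U. access_cost A \<pi> \<le> k} \<le> 2 ^ (9 * k + 2)"
proof -
  let ?C = "{\<pi>\<in>U. access_cost A \<pi> \<le> k}"
  \<comment> \<open>The initial tree takes \<open>2 * n + 1\<close> bits, where
    \<open>n \<le> k\<close> if \<open>?C\<close> is nonempty, and the run takes at most
    \<open>7 * k\<close>.\<close>
  let ?B = "{bs :: bool list. set bs \<subseteq> UNIV \<and> length bs \<le> 9 * k + 1}"
  define code where
    "code \<pi> = shape_code (fst (A \<pi>)) @ run_code (access_seq n \<pi>) (snd (A \<pi>))" for \<pi>
  have alg: "bst (fst (A \<pi>))" "set_tree (fst (A \<pi>)) = {1..n}"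
      "serves (fst (A \<pi>)) (access_seq n \<pi>) (snd (A \<pi>))" if "\<pi> \<in> U" for \<pi>
    using A that by (auto simp: bst_algorithm_def)
  have "inj_on code ?C"
  proof
    fix \<pi> \<sigma> assume *: "\<pi> \<in> ?C" "\<sigma> \<in> ?C" "code \<pi> = code \<sigma>"
    then have "shape (fst (A \<pi>)) = shape (fst (A \<sigma>))"
      and run: "run_code (access_seq n \<pi>) (snd (A \<pi>)) = run_code (access_seq n \<sigma>) (snd (A \<sigma>))"
      by (auto simp: code_def dest!: shape_code_append_eqD)
    then have "fst (A \<pi>) = fst (A \<sigma>)" using alg * by (auto intro: bst_eq_if_shape_set_eq)
    then have "access_seq n \<pi> = access_seq n \<sigma>"
      using run alg(3)[of \<pi>] alg(3)[of \<sigma>] * by (auto intro: run_code_inj)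
    then show "\<pi> = \<sigma>" using U * by (intro access_seq_inj[of \<pi> n \<sigma>]) blast+
  qed
  moreover have "code ` ?C \<subseteq> ?B"
  proof (rule image_subsetI)
    fix \<pi> assume *: "\<pi> \<in> ?C"
    then have "size (fst (A \<pi>)) = n" using alg by (simp add: size_bst)
    moreover have "n \<le> access_cost A \<pi>" using A * by (simp add: access_cost_ge)
    moreover have "length (run_code (access_seq n \<pi>) (snd (A \<pi>))) \<le> 7 * access_cost A \<pi>"
      using serves_cost_bounds[OF alg(3)] * by (simp add: access_cost_def)
    ultimately show "code \<pi> \<in> ?B" using * by (simp add: code_def)
  qed
  moreover have "finite ?B" by (rule finite_lists_length_le) simp
  ultimately have "card ?C \<le> card ?B" by (rule card_inj_on_le)
  also have "\<dots> = (\<Sum>i\<le>9 * k + 1. 2 ^ i)"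
    by (subst card_lists_length_le) auto
  also have "\<dots> \<le> 2 ^ (9 * k + 2)"
    using mask_eq_sum_exp_nat[of "9 * k + 2"]
    by (simp add: lessThan_Suc_atMost[symmetric] lessThan_def)
  finally show ?thesis .
qed

lemma card_bad_permutations:
  fixes \<epsilon> c :: real
  assumes c: "0 < c" "c \<le> 1 / 2" "22 * c \<le> 1 - \<epsilon>"
    and U: "U \<subseteq> {\<pi>. \<pi> permutes {1..n}}" and A: "bst_algorithm n U A"
  shows "real (card {\<pi>\<in>U. real (access_cost A \<pi>) < c * (log 2 (real (card U)) + real n)})
    \<le> real (card U) powr (1 - \<epsilon>)" (is "real (card ?bad) \<le> _")
proof (cases "?bad = {}")
  case True
  show ?thesis unfolding True by simp
next
  case False
  have fin: "finite U" using U finite_permutations[of "{1..n}"] finite_subset by blast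
  define u where "u = real (card U)"
  have u: "u \<ge> 1"
    using False fin by (auto simp: u_def Suc_le_eq card_gt_0_iff)
  \<comment> \<open>Since \<open>n\<close> is at most the access cost and
    \<open>c \<le> 1 / 2\<close>, the summand \<open>c * n\<close> accounts for at most half of the
    cost. Moving it to the other side doubles the logarithmic term.\<close>
  define k where "k = nat \<lfloor>2 * c * log 2 u\<rfloor>"
  have cheap: "access_cost A \<pi> \<le> k" if "\<pi> \<in> ?bad" for \<pi>
  proof -
    have "c * real n \<le> 1 / 2 * real (access_cost A \<pi>)"
      using access_cost_ge[OF A, of \<pi>] that c by (intro mult_mono) auto
    with that have "real (access_cost A \<pi>) \<le> 2 * c * log 2 u"
      by (simp add: u_def algebra_simps)
    then show ?thesis unfolding k_def by linarith
  qed
  \<comment> \<open>Needed for \<open>k \<ge> 1\<close>, which turns the exponent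
    \<open>9 * k + 2\<close> into \<open>11 * k\<close>. For \<open>n = 0\<close> the threshold is
    0, and no permutation is bad.\<close>
  have "n > 0"
  proof (rule ccontr)
    assume "\<not> n > 0"
    then have "U \<subseteq> {id}" using U by auto
    then have "card U \<le> 1" using card_mono[of "{id}" U] by simp
    with u have "u = 1" by (simp add: u_def)
    with False \<open>\<not> n > 0\<close> show False by (auto simp: u_def)
  qed
  moreover from False obtain \<pi> where "\<pi> \<in> ?bad" by blast
  ultimately have "k \<ge> 1" using cheap[of \<pi>] access_cost_ge[OF A, of \<pi>] by auto
  have "real (card ?bad) \<le> real (card {\<pi>\<in>U. access_cost A \<pi> \<le> k})"
    using fin cheap by (intro of_nat_mono card_mono) auto
  also have "\<dots> \<le> real (2 ^ (9 * k + 2))"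
    using card_cheap_permutations[OF U A, of k] by (rule of_nat_mono)
  also have "\<dots> \<le> 2 ^ (11 * k)"
    using \<open>k \<ge> 1\<close> by (simp del: power_Suc power_add add: power_increasing)
  also have "\<dots> = 2 powr (11 * real k)"
    using powr_realpow[of "2::real" "11 * k"] by simp
  also have "\<dots> \<le> 2 powr (log 2 u * (1 - \<epsilon>))"
  proof (rule powr_mono)
    have "log 2 u \<ge> 0" using u by simp
    \<comment> \<open>Nonnegativity ensures that \<open>nat\<close> does not round up a negative
      value, so that \<open>k\<close> is at most \<open>2 * c * log 2 u\<close>.\<close>
    then have "2 * c * log 2 u \<ge> 0" using c by simp
    then have "11 * real k \<le> 22 * c * log 2 u" unfolding k_def by linarith
    also have "\<dots> \<le> (1 - \<epsilon>) * log 2 u" using c \<open>log 2 u \<ge> 0\<close> by (intro mult_right_mono) auto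
    finally show "11 * real k \<le> log 2 u * (1 - \<epsilon>)" by (simp add: mult.commute)
  qed simp
  also have "\<dots> = u powr (1 - \<epsilon>)"
    using u by (simp add: powr_powr[symmetric])
  finally show ?thesis unfolding u_def .
qed

theorem theorem33:
  fixes \<epsilon> :: real
  assumes "\<epsilon> < 1"
  shows "\<exists>c>0. \<forall>(n::nat) (U :: (nat \<Rightarrow> nat) set) A.
    U \<subseteq> {\<pi>. \<pi> permutes {1..n}} \<longrightarrow> bst_algorithm n U A \<longrightarrow>
    (\<exists>U' \<subseteq> U.
       real (card U') \<ge> (1 - 1 / real (card U) powr \<epsilon>) * real (card U) \<and>
       (\<forall>\<pi>\<in>U'. real (access_cost A \<pi>) \<ge> c * (log 2 (real (card U)) + real n)))"
proof -
  \<comment> \<open>The bound 1 / 2 absorbs the term \<open>n\<close>. The 22 is the factor 11 in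
    the exponent of the counting bound times the 2 lost by this absorption.\<close>
  define c where "c = min (1 / 2) ((1 - \<epsilon>) / 22)"
  have c: "0 < c" "c \<le> 1 / 2" "22 * c \<le> 1 - \<epsilon>" using assms by (auto simp: c_def min_def)
  show ?thesis
  proof (intro exI[of _ c] conjI allI impI c(1))
    fix n :: nat and U :: "(nat \<Rightarrow> nat) set" and A
    assume U: "U \<subseteq> {\<pi>. \<pi> permutes {1..n}}" and A: "bst_algorithm n U A"
    let ?bad = "{\<pi>\<in>U. real (access_cost A \<pi>) < c * (log 2 (real (card U)) + real n)}"
    have fin: "finite U" using U finite_permutations[of "{1..n}"] finite_subset by blast
    have "(1 - 1 / real (card U) powr \<epsilon>) * real (card U) =
        real (card U) - real (card U) powr (1 - \<epsilon>)"
      \<comment> \<open>For empty \<open>U\<close> both sides are 0, because \<open>powr\<close>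
        with base 0 is 0.\<close>
      by (cases "card U = 0") (simp_all add: powr_diff algebra_simps)
    also have "\<dots> \<le> real (card U) - real (card ?bad)"
      using card_bad_permutations[OF c U A] by simp
    also have "\<dots> = real (card (U - ?bad))"
      using fin by (subst card_Diff_subset) (auto simp: of_nat_diff card_mono)
    finally show "\<exists>U' \<subseteq> U.
       real (card U') \<ge> (1 - 1 / real (card U) powr \<epsilon>) * real (card U) \<and>
       (\<forall>\<pi>\<in>U'. real (access_cost A \<pi>) \<ge> c * (log 2 (real (card U)) + real n))"
      by (intro exI[of _ "U - ?bad"]) auto
  qed
qed

end
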